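(* If $n=p^\alpha q^\beta$, where $p,q$ are distinct primes and $\alpha,\beta \in \mathbb{N}$, then $$\kappa(\mathcal{G}(\mathbb{Z}_n)) = \phi(n)+p^{\alpha-1}q^{\beta-1}.$$ In fact, for $n \ne pq$, $\langle \overline{pq}\rangle^*$ is a minimum separating set of $\widetilde{\mathcal{G}}(\mathbb{Z}_n)$.
   Context: $\mathbb{N}$ denotes the positive integers and $\phi$ is Euler's phi function. $\mathbb{Z}_n$ is the additive group of integers modulo $n$, and $\overline{a}$ is the residue class of $a$. The power graph $\mathcal{G}(\mathbb{Z}_n)$ is the simple undirected graph with vertex set $\mathbb{Z}_n$ in which two distinct vertices are adjacent if one is a positive integer multiple of the other. $\langle x\rangle$ is the cyclic subgroup generated by $x$, and $A^*=A\setminus\{\overline{0}\}$ for $A\subseteq\mathbb{Z}_n$. Let $\mathcal{S}(\mathbb{Z}_n)=\{\overline{a} : 1\le a<n,\ \gcd(a,n)=1\}\cup\{\overline{0}\}$, and let $\widetilde{\mathcal{G}}(\mathbb{Z}_n)$ be the graph obtained from $\mathcal{G}(\mathbb{Z}_n)$ by deleting all vertices in $\mathcal{S}(\mathbb{Z}_n)$. The vertex connectivity $\kappa(\Gamma)$ of a graph $\Gamma$ is the minimum number of vertices whose removal results in a disconnected graph or a trivial graph (one vertex, no edges). A separating set of $\Gamma$ is a set of vertices whose removal increases the number of components of $\Gamma$; a minimum separating set is a separating set of least cardinality. *)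

theory Defs
  imports
    "HOL-Algebra.Elementary_Groups"
    "HOL-Algebra.Generated_Groups"
    "HOL-Number_Theory.Totient"
    "Graph_Theory.Digraph_Component"
begin

text \<open>
  Simple undirected graphs are symmetric loop-free pair digraphs (locale \<^term>\<open>pair_graph\<close>): an edge
  between \<open>x\<close> and \<open>y\<close> is the pair of arcs \<open>(x, y)\<close>, \<open>(y, x)\<close>.
\<close>

definition power_graph :: "('a, 'b) monoid_scheme \<Rightarrow> 'a pair_pre_digraph" where
  "power_graph G =
     \<lparr>pverts = carrier G,
      parcs = {(x, y). x \<in> carrier G \<and> y \<in> carrier G \<and> x \<noteq> y \<and>
                 (\<exists>k::nat. k \<ge> 1 \<and> (y = x [^]\<^bsub>G\<^esub> k \<or> x = y [^]\<^bsub>G\<^esub> k))}\<rparr>"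

lemma pair_graph_power_graph:
  assumes "finite (carrier G)"
  shows "pair_graph (power_graph G)"
proof
  have "parcs (power_graph G) \<subseteq> carrier G \<times> carrier G"
    by (auto simp: power_graph_def)
  then show "finite (parcs (power_graph G))"
    using assms by (meson finite_SigmaI finite_subset)
  show "symmetric (power_graph G)"
    by (auto simp: symmetric_def sym_def power_graph_def)
qed (auto simp: power_graph_def assms)

definition delete_verts :: "('a, 'b) pre_digraph \<Rightarrow> 'a set \<Rightarrow> ('a, 'b) pre_digraph" where
  "delete_verts \<Gamma> X = \<Gamma> \<restriction> (verts \<Gamma> - X)"

text \<open>
  \<^const>\<open>Digraph_Component.connected\<close> fails for the graph without vertices, which is not meant to
  count as disconnected.
\<close>

definition disconnected :: "('a, 'b) pre_digraph \<Rightarrow> bool" where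
  "disconnected \<Gamma> \<longleftrightarrow> verts \<Gamma> \<noteq> {} \<and> \<not> Digraph_Component.connected \<Gamma>"

definition trivial_graph :: "('a, 'b) pre_digraph \<Rightarrow> bool" where
  "trivial_graph \<Gamma> \<longleftrightarrow> card (verts \<Gamma>) = 1 \<and> arcs \<Gamma> = {}"

text \<open>The next definitions are meant for finite graphs; the first one also needs a vertex.\<close>

definition vertex_connectivity :: "('a, 'b) pre_digraph \<Rightarrow> nat" where
  "vertex_connectivity \<Gamma> =
     (LEAST k. \<exists>X \<subseteq> verts \<Gamma>. card X = k \<and>
        (disconnected (delete_verts \<Gamma> X) \<or> trivial_graph (delete_verts \<Gamma> X)))"

text \<open>Strongly connected components of a symmetric digraph are the components of the graph.\<close>

definition separating_set :: "('a, 'b) pre_digraph \<Rightarrow> 'a set \<Rightarrow> bool" where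
  "separating_set \<Gamma> X \<longleftrightarrow> X \<subseteq> verts \<Gamma> \<and>
     card (pre_digraph.sccs (delete_verts \<Gamma> X)) > card (pre_digraph.sccs \<Gamma>)"

definition minimum_separating_set :: "('a, 'b) pre_digraph \<Rightarrow> 'a set \<Rightarrow> bool" where
  "minimum_separating_set \<Gamma> X \<longleftrightarrow> separating_set \<Gamma> X \<and>
     (\<forall>Y. separating_set \<Gamma> Y \<longrightarrow> card X \<le> card Y)"

text \<open>
  The carrier of \<^term>\<open>integer_mod_group n\<close>, for \<open>n > 0\<close>, is the set of least nonnegative residues;
  its group operation is addition, so \<open>x [^] k\<close> is the multiple \<open>k x\<close>.
\<close>

definition residue_class :: "nat \<Rightarrow> nat \<Rightarrow> int" where
  "residue_class n a = int a mod int n"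

definition S_set :: "nat \<Rightarrow> int set" where
  "S_set n = {residue_class n a |a. 1 \<le> a \<and> a < n \<and> gcd a n = 1} \<union> {residue_class n 0}"

definition reduced_power_graph :: "nat \<Rightarrow> (int, int \<times> int) pre_digraph" where
  "reduced_power_graph n = delete_verts (power_graph (integer_mod_group n)) (S_set n)"

definition cyclic_subgroup :: "nat \<Rightarrow> int \<Rightarrow> int set" where
  "cyclic_subgroup n x = generate (integer_mod_group n) {x}"

definition nonzero_part :: "nat \<Rightarrow> int set \<Rightarrow> int set" where
  "nonzero_part n A = A - {residue_class n 0}"

end

theory Submission
  imports Defs
begin

text \<open>
  Two residues \<open>x \<noteq> y\<close> are adjacent in the power graph of \<open>\<int>\<^sub>n\<close> exactly when one of
  \<open>gcd x n\<close>, \<open>gcd y n\<close> divides the other, so only divisibility by powers of \<open>p\<close> and \<open>q\<close> matters.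
  Write \<open>D\<close> for the set of multiples of \<open>pq\<close>; it has \<open>p^(\<alpha>-1) q^(\<beta>-1)\<close> elements, and it is the
  subgroup generated by \<open>pq\<close>.

  Deleting the \<open>\<phi>(n)\<close> units and \<open>D\<close> leaves the residues divisible by exactly one of the two primes, and
  no edge joins a residue of one kind to one of the other kind
  (\<open>disconnected_delete_S_multiples\<close>). This is the upper bound.

  For the lower bound (\<open>card_disconnecting_set\<close>) let the deletion of \<open>X\<close> disconnect the graph. A unit is
  adjacent to every vertex, so \<open>X\<close> contains all units, and it remains to find \<open>|D|\<close> non-units in \<open>X\<close>.
  If every residue divisible by \<open>q\<close> but not by \<open>p\<close> is in \<open>X\<close>, then the translate
  \<open>D + q\<^sup>\<beta>\<close> lies in \<open>X\<close>; symmetrically for \<open>p\<close>. Otherwise choose a remaining residue \<open>u\<close> of the first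
  kind and a remaining residue \<open>v\<close> of the second kind whose gcds \<open>a\<close>, \<open>b\<close> with \<open>n\<close> are as small as
  possible. A remaining common multiple \<open>w\<close> of \<open>a\<close> and \<open>b\<close> would be adjacent to \<open>u\<close>, to \<open>v\<close>, and to each
  vertex that \<open>a\<close> and \<open>b\<close> both fail to divide, which would make the rest connected. So the elements of \<open>D\<close>
  divisible by both \<open>a\<close> and \<open>b\<close> are in \<open>X\<close>. An element not divisible by \<open>a\<close> is translated by \<open>q\<^sup>\<beta>\<close>: this
  keeps its residue modulo \<open>a\<close> and destroys the divisibility by \<open>p\<close>, so by minimality of \<open>a\<close> the
  translate is in \<open>X\<close>. The remaining elements are translated by \<open>p\<^sup>\<alpha>\<close>. The three images are disjoint, since
  they consist of residues divisible by both primes, by \<open>q\<close> only, and by \<open>p\<close> only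
  (\<open>card_multiples_le_by_translation\<close>).

  For the reduced graph, separating sets are exactly the sets whose deletion, together with the units
  and \<open>0\<close>, disconnects the full graph: if \<open>n \<noteq> pq\<close>, the reduced graph is connected through the nonzero
  vertex \<open>pq\<close>, which is adjacent to \<open>p\<close> and to \<open>q\<close>. The minimality of \<open>D - {0}\<close> is then the same lower bound.
\<close>

section \<open>Components of finite graphs\<close>

lemma delete_verts_delete_verts:
  "delete_verts (delete_verts \<Gamma> X) Y = delete_verts \<Gamma> (X \<union> Y)"
  by (auto simp: delete_verts_def induce_subgraph_def)

lemma (in pseudo_graph) pseudo_graph_delete_verts: "pseudo_graph (delete_verts G X)"
proof -
  have *: "induced_subgraph (delete_verts G X) G"
    by (auto simp: delete_verts_def)
  interpret H: fin_digraph "delete_verts G X"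
    using * by (intro fin_digraph_subgraph induced_imp_subgraph)
  interpret H: sym_digraph "delete_verts G X"
    using * by (rule induced_graph_imp_graph)
  show ?thesis ..
qed

lemma (in sym_digraph) connected_iff_strongly_connected:
  "Digraph_Component.connected G \<longleftrightarrow> strongly_connected G"
  unfolding Digraph_Component.connected_def strongly_connected_def
  by (simp add: reachable_mk_symmetric_eq[OF sym_arcs])

lemma (in pseudo_graph) disconnected_iff_card_sccs: "disconnected G \<longleftrightarrow> card sccs > 1"
proof
  assume "card sccs > 1"
  then have "verts G \<noteq> {}" "sccs \<noteq> {G}"
    using card_sccs_verts sccs_verts_conv_scc_of by auto
  then show "disconnected G"
    by (simp add: disconnected_def connected_iff_strongly_connected strongly_connected_eq_iff)
next
  assume "disconnected G"
  then obtain u v where uv: "u \<in> verts G" "v \<in> verts G" "\<not> u \<rightarrow>\<^sup>* v"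
    unfolding disconnected_def connected_iff_strongly_connected strongly_connected_def by blast
  then have "scc_of u \<noteq> scc_of v"
    using in_scc_of_self[of v] by (auto simp: scc_of_def)
  then have "card {scc_of u, scc_of v} = 2" by simp
  moreover have "card {scc_of u, scc_of v} \<le> card sccs_verts"
    using uv finite_sccs_verts by (intro card_mono) (auto simp: scc_of_in_sccs_verts)
  ultimately show "card sccs > 1"
    by (simp add: card_sccs_verts)
qed

lemma (in sym_digraph) strongly_connected_if_all_reachable:
  assumes "w \<in> verts G" "\<And>x. x \<in> verts G \<Longrightarrow> w \<rightarrow>\<^sup>* x"
  shows "strongly_connected G"
  using assms by (intro strongly_connectedI) (auto intro: reachable_trans symmetric_reachable')

lemma (in wf_digraph) reachable_in_closed_set:
  assumes "u \<rightarrow>\<^sup>* v" "u \<in> A" "\<And>x y. x \<in> A \<Longrightarrow> x \<rightarrow> y \<Longrightarrow> y \<in> A"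
  shows "v \<in> A"
  using assms(1,2) by (induction rule: converse_reachable_induct) (auto intro: assms(3))

section \<open>The power graph of a finite cyclic group\<close>

abbreviation cyclic_power_graph :: "nat \<Rightarrow> (int, int \<times> int) pre_digraph" where
  "cyclic_power_graph n \<equiv> with_proj (power_graph (integer_mod_group n))"

text \<open>
  A solution \<open>m\<close> of the congruence \<open>x m = y\<close> modulo \<open>n\<close> exists by Bezout; adding \<open>n\<close> to its least
  nonnegative residue makes it positive.
\<close>
lemma multiple_mod_iff_gcd_dvd:
  fixes x y :: int
  assumes "n > 0" "0 \<le> y" "y < int n"
  shows "(\<exists>k::nat. k \<ge> 1 \<and> y = (int k * x) mod int n) \<longleftrightarrow> gcd x (int n) dvd y"
proof
  assume "gcd x (int n) dvd y"
  then obtain m where m: "[x * m = y] (mod int n)"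
    using cong_solve_dvd_int by (metis)
  define k where "k = nat (m mod int n) + n"
  have "int k mod int n = m mod int n"
    using assms by (simp add: k_def)
  then have "(int k * x) mod int n = (m * x) mod int n"
    by (metis mod_mult_left_eq)
  also have "\<dots> = y"
    using m assms by (simp add: cong_def mult.commute)
  finally show "\<exists>k::nat. k \<ge> 1 \<and> y = (int k * x) mod int n"
    using assms by (intro exI[of _ k]) (auto simp: k_def)
qed (auto simp: dvd_mod)

lemma verts_cyclic_power_graph:
  "n > 0 \<Longrightarrow> verts (cyclic_power_graph n) = {0..<int n}"
  by (simp add: power_graph_def carrier_integer_mod_group)

lemma pseudo_graph_cyclic_power_graph:
  "n > 0 \<Longrightarrow> pseudo_graph (cyclic_power_graph n)"
  using pair_graph_power_graph[of "integer_mod_group n"]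
  by (auto simp: carrier_integer_mod_group dest!: pair_graph.pair_graphD_graph graph.axioms
      intro: pseudo_graph.intro)

lemma adjacent_cyclic_power_graph_iff:
  assumes "n > 0"
  shows "x \<rightarrow>\<^bsub>delete_verts (cyclic_power_graph n) X\<^esub> y \<longleftrightarrow>
    x \<in> {0..<int n} - X \<and> y \<in> {0..<int n} - X \<and> x \<noteq> y \<and>
    (gcd x (int n) dvd y \<or> gcd y (int n) dvd x)"
proof -
  have "x \<rightarrow>\<^bsub>delete_verts (cyclic_power_graph n) X\<^esub> y \<longleftrightarrow>
    (x, y) \<in> parcs (power_graph (integer_mod_group n)) \<and> x \<in> {0..<int n} - X \<and> y \<in> {0..<int n} - X"
    using assms
    by (auto simp: delete_verts_def arcs_ends_conv induce_subgraph_def image_iff verts_cyclic_power_graph[simplified])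
  also have "\<dots> \<longleftrightarrow> x \<in> {0..<int n} - X \<and> y \<in> {0..<int n} - X \<and> x \<noteq> y \<and>
    ((\<exists>k::nat. k \<ge> 1 \<and> y = (int k * x) mod int n) \<or> (\<exists>k::nat. k \<ge> 1 \<and> x = (int k * y) mod int n))"
    using assms by (auto simp: power_graph_def carrier_integer_mod_group)
  also have "\<dots> \<longleftrightarrow> x \<in> {0..<int n} - X \<and> y \<in> {0..<int n} - X \<and> x \<noteq> y \<and>
    (gcd x (int n) dvd y \<or> gcd y (int n) dvd x)"
    using multiple_mod_iff_gcd_dvd[of n] assms by auto
  finally show ?thesis .
qed

lemma reachable_cyclic_power_graphI:
  assumes "n > 0" "x \<in> {0..<int n} - X" "y \<in> {0..<int n} - X"
    and "gcd x (int n) dvd y \<or> gcd y (int n) dvd x"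
  shows "x \<rightarrow>\<^sup>*\<^bsub>delete_verts (cyclic_power_graph n) X\<^esub> y"
proof -
  interpret H: pseudo_graph "delete_verts (cyclic_power_graph n) X"
    using assms by (intro pseudo_graph.pseudo_graph_delete_verts pseudo_graph_cyclic_power_graph)
  show ?thesis
  proof (cases "x = y")
    case True
    have "y \<in> verts (delete_verts (cyclic_power_graph n) X)"
      using assms by (simp add: delete_verts_def verts_cyclic_power_graph[simplified])
    then show ?thesis unfolding True by (rule H.reachable_refl)
  next
    case False
    then show ?thesis using assms
      by (intro H.reachable_adjI) (simp add: adjacent_cyclic_power_graph_iff)
  qed
qed

definition multiples :: "nat \<Rightarrow> int \<Rightarrow> int set" where
  "multiples n d = {x \<in> {0..<int n}. d dvd x}"

definition unit_residues :: "nat \<Rightarrow> int set" where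
  "unit_residues n = {x \<in> {0..<int n}. coprime x (int n)}"

lemma finite_multiples: "finite (multiples n d)"
  and finite_unit_residues: "finite (unit_residues n)"
  by (rule finite_subset[of _ "{0..<int n}"]; auto simp: multiples_def unit_residues_def)+

lemma card_unit_residues:
  assumes "n > 1" shows "card (unit_residues n) = totient n"
proof -
  have "unit_residues n = int ` totatives n"
  proof (intro equalityI subsetI)
    fix x assume x: "x \<in> unit_residues n"
    then have "x \<noteq> 0" using assms by (auto simp: unit_residues_def)
    with x have "nat x \<in> totatives n" "x = int (nat x)"
      by (auto simp: unit_residues_def in_totatives_iff coprime_int_iff[symmetric])
    then show "x \<in> int ` totatives n" by blast
  next
    fix x assume "x \<in> int ` totatives n"
    then obtain k where "x = int k" "0 < k" "k \<le> n" "coprime k n"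
      by (auto simp: in_totatives_iff)
    moreover from this have "k \<noteq> n" using assms by auto
    ultimately show "x \<in> unit_residues n" by (auto simp: unit_residues_def)
  qed
  then show ?thesis
    by (simp add: card_image totient_def)
qed

lemma S_set_eq:
  assumes "n > 1" shows "S_set n = unit_residues n \<union> {0}"
proof -
  have "{residue_class n a |a. 1 \<le> a \<and> a < n \<and> gcd a n = 1} = unit_residues n"
  proof (intro equalityI subsetI)
    fix x assume "x \<in> {residue_class n a |a. 1 \<le> a \<and> a < n \<and> gcd a n = 1}"
    then show "x \<in> unit_residues n"
      by (auto simp: residue_class_def unit_residues_def coprime_iff_gcd_eq_1 simp del: One_nat_def)
  next
    fix x assume x: "x \<in> unit_residues n"
    then have "x \<noteq> 0" using assms by (auto simp: unit_residues_def)
    with x have x': "0 < x" "x < int n" "coprime x (int n)" by (auto simp: unit_residues_def)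
    then have "coprime (int (nat x)) (int n)" by simp
    then have "gcd (nat x) n = 1" by (simp only: coprime_int_iff coprime_imp_gcd_eq_1)
    moreover have "x = residue_class n (nat x)" "1 \<le> nat x" "nat x < n"
      using x'(1,2) by (simp_all add: residue_class_def)
    ultimately show "x \<in> {residue_class n a |a. 1 \<le> a \<and> a < n \<and> gcd a n = 1}"
      by (intro CollectI exI[of _ "nat x"] conjI)
  qed
  then show ?thesis by (simp add: S_set_def residue_class_def)
qed

lemma card_multiples:
  assumes "d > 0" "n = d * m" shows "card (multiples n (int d)) = m"
proof -
  have "multiples n (int d) = (\<lambda>k. int d * int k) ` {..<m}"
  proof (intro equalityI subsetI)
    fix x assume x: "x \<in> multiples n (int d)"
    then obtain k where k: "x = int d * k" unfolding multiples_def by blast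
    with x have "0 \<le> int d * k" "int d * k < int d * int m"
      using assms by (auto simp: multiples_def)
    then have "0 \<le> k" "k < int m"
      using assms(1) by (auto simp: zero_le_mult_iff)
    then show "x \<in> (\<lambda>k. int d * int k) ` {..<m}"
      using k by (intro image_eqI[of _ _ "nat k"]) auto
  next
    fix x assume "x \<in> (\<lambda>k. int d * int k) ` {..<m}"
    then show "x \<in> multiples n (int d)"
      using assms by (auto simp: multiples_def simp flip: of_nat_mult)
  qed
  moreover have "inj_on (\<lambda>k. int d * int k) {..<m}"
    using assms(1) by (auto simp: inj_on_def)
  ultimately show ?thesis by (simp add: card_image)
qed

lemma cyclic_subgroup_eq_multiples:
  assumes "n > 0" "d dvd n"
  shows "cyclic_subgroup n (residue_class n d) = multiples n (int d)"
proof -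
  have "residue_class n d \<in> carrier (integer_mod_group n)"
    using assms by (simp add: carrier_integer_mod_group residue_class_def)
  then have "cyclic_subgroup n (residue_class n d) = range (\<lambda>k. (k * int d) mod int n)"
    unfolding cyclic_subgroup_def
    by (subst group.generate_pow)
       (auto simp: int_pow_integer_mod_group residue_class_def mod_mult_right_eq)
  also have "\<dots> = multiples n (int d)"
  proof (intro equalityI subsetI)
    fix x assume "x \<in> multiples n (int d)"
    then have x: "0 \<le> x" "x < int n" "int d dvd x" by (auto simp: multiples_def)
    then obtain k where "x = int d * k" by blast
    with x have "x = (k * int d) mod int n" by (simp add: mult.commute)
    then show "x \<in> range (\<lambda>k. (k * int d) mod int n)" by blast
  qed (use assms in \<open>auto simp: multiples_def intro!: dvd_mod\<close>)
  finally show ?thesis .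
qed

lemma inj_on_translation_mod:
  fixes n :: int shows "inj_on (\<lambda>x. (x + c) mod n) {0..<n}"
proof (rule inj_onI)
  fix x y assume *: "x \<in> {0..<n}" "y \<in> {0..<n}" "(x + c) mod n = (y + c) mod n"
  then have "x mod n = y mod n"
    by (metis add_diff_cancel_right' mod_diff_left_eq)
  then show "x = y" using * by simp
qed

section \<open>Divisors of prime powers\<close>

lemma dvd_prime_power_comparable:
  fixes p a b :: int
  assumes "prime p" "a dvd p ^ k" "b dvd p ^ k"
  shows "a dvd b \<or> b dvd a"
proof -
  obtain i where "normalize a = normalize (p ^ i)"
    using assms divides_primepow_weak by blast
  moreover obtain j where "normalize b = normalize (p ^ j)"
    using assms divides_primepow_weak by blast
  moreover have "p ^ i dvd p ^ j \<or> p ^ j dvd p ^ i"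
    by (meson le_imp_power_dvd linear)
  ultimately show ?thesis
    by (metis associated_iff_dvd dvd_trans)
qed

text \<open>
  The gcds with \<open>p\<^sup>k\<close> form a chain under divisibility, so the smallest of them divides all the others.
\<close>
lemma ex_least_prime_power_part:
  fixes p :: int
  assumes "prime p" "U \<noteq> {}"
  shows "\<exists>u\<in>U. \<forall>x\<in>U. gcd u (p ^ k) dvd x"
proof -
  obtain u where u: "u \<in> U" "\<And>x. x \<in> U \<Longrightarrow> nat (gcd u (p ^ k)) \<le> nat (gcd x (p ^ k))"
    using assms(2) ex_has_least_nat[of "\<lambda>x. x \<in> U" _ "\<lambda>x. nat (gcd x (p ^ k))"] by blast
  have "gcd u (p ^ k) dvd x" if "x \<in> U" for x
  proof -
    have le: "gcd u (p ^ k) \<le> gcd x (p ^ k)"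
      using u(2)[OF that] nat_le_eq_zle[of "gcd u (p ^ k)" "gcd x (p ^ k)"] by (metis gcd_ge_0_int)
    have pos: "gcd u (p ^ k) > 0"
      using assms(1) by (simp add: gcd_pos_int prime_gt_0_int)
    consider "gcd u (p ^ k) dvd gcd x (p ^ k)" | "gcd x (p ^ k) dvd gcd u (p ^ k)"
      using dvd_prime_power_comparable[OF assms(1), of "gcd u (p ^ k)" k "gcd x (p ^ k)"] by auto
    then show ?thesis
    proof cases
      case 2
      with le pos have "gcd x (p ^ k) = gcd u (p ^ k)"
        by (simp add: zdvd_imp_le antisym)
      then show ?thesis by (metis gcd_dvd1)
    qed auto
  qed
  with u(1) show ?thesis by blast
qed

text \<open>
  Each prime-power factor of the gcd is comparable with the divisor \<open>a\<close> or \<open>b\<close> at the same prime, and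
  it must be the smaller one because \<open>x\<close> is not divisible by \<open>a\<close> or \<open>b\<close>. In the graph this makes every
  common multiple \<open>w\<close> of \<open>a\<close> and \<open>b\<close> a neighbour of \<open>x\<close>.
\<close>
lemma gcd_dvd_if_prime_powers_not_dvd:
  fixes p q a b w x :: int
  assumes "prime p" "prime q" "p \<noteq> q"
    and "a dvd q ^ \<beta>" "b dvd p ^ \<alpha>" "a dvd w" "b dvd w"
    and "\<not> a dvd x" "\<not> b dvd x"
  shows "gcd x (p ^ \<alpha> * q ^ \<beta>) dvd w"
proof -
  obtain c d where cd: "gcd x (p ^ \<alpha> * q ^ \<beta>) = c * d" "c dvd p ^ \<alpha>" "d dvd q ^ \<beta>"
    using division_decomp[of "gcd x (p ^ \<alpha> * q ^ \<beta>)" "p ^ \<alpha>" "q ^ \<beta>"] by auto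
  have "c dvd x" "d dvd x"
    using cd(1) by (metis dvd_triv_left dvd_trans gcd_dvd1, metis dvd_triv_right dvd_trans gcd_dvd1)
  then have "\<not> a dvd d" "\<not> b dvd c"
    using assms dvd_trans by blast+
  then have "d dvd a" "c dvd b"
    using dvd_prime_power_comparable cd assms by blast+
  then have "d dvd w" "c dvd w"
    using assms dvd_trans by blast+
  moreover have "coprime c d"
  proof (rule coprime_divisors[OF cd(2,3)])
    show "coprime (p ^ \<alpha>) (q ^ \<beta>)"
      using assms(1-3) by (simp add: primes_coprime)
  qed
  ultimately show ?thesis
    using cd(1) by (simp add: divides_mult)
qed

section \<open>Orders with two prime divisors\<close>

locale two_prime_divisors =
  fixes p q \<alpha> \<beta> n :: nat
  assumes prime_p: "prime p" and prime_q: "prime q" and p_neq_q: "p \<noteq> q"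
    and \<alpha>_pos: "\<alpha> \<ge> 1" and \<beta>_pos: "\<beta> \<ge> 1"
    and n_eq: "n = p ^ \<alpha> * q ^ \<beta>"
begin

lemma swap: "two_prime_divisors q p \<beta> \<alpha> n"
  using prime_p prime_q p_neq_q \<alpha>_pos \<beta>_pos n_eq by unfold_locales auto

lemma n_eq_mult: "n = (p * q) * (p ^ (\<alpha> - 1) * q ^ (\<beta> - 1))"
proof -
  have "p ^ \<alpha> = p * p ^ (\<alpha> - 1)" "q ^ \<beta> = q * q ^ (\<beta> - 1)"
    using \<alpha>_pos \<beta>_pos by (simp_all flip: power_Suc)
  then show ?thesis by (simp add: n_eq)
qed

lemma dvd_n: "p * q dvd n" "p dvd n" "q dvd n"
  by (subst n_eq_mult, simp)+

lemma int_dvd_n: "int (p * q) dvd int n" "int p dvd int n" "int q dvd int n"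
  using dvd_n by (simp_all only: int_dvd_int_iff)

lemma p_less_n: "p < n"
proof -
  have "p < p * q" using prime_p prime_q by (simp add: prime_gt_0_nat prime_gt_Suc_0_nat)
  also have "p * q \<le> n" using dvd_n(1) prime_p prime_q by (intro dvd_imp_le) (auto simp: n_eq prime_gt_0_nat)
  finally show ?thesis .
qed

lemma n_gt_1: "n > 1"
  using p_less_n prime_gt_1_nat[OF prime_p] by simp

lemma int_primes: "prime (int p)" "prime (int q)" "int p \<noteq> int q"
  using prime_p prime_q p_neq_q by simp_all

lemma not_dvd: "\<not> int p dvd int q" "\<not> int q dvd int p"
  using prime_p prime_q p_neq_q primes_dvd_imp_eq by (auto simp: int_dvd_int_iff)

lemma pq_dvd_iff: "int (p * q) dvd x \<longleftrightarrow> int p dvd x \<and> int q dvd x"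
proof
  assume "int p dvd x \<and> int q dvd x"
  then show "int (p * q) dvd x"
    using divides_mult[of "int p" x "int q"] primes_coprime[OF int_primes] by simp
qed (auto elim: dvd_mult_left dvd_mult_right)

lemma coprime_n_iff: "coprime x (int n) \<longleftrightarrow> \<not> int p dvd x \<and> \<not> int q dvd x"
proof -
  have "coprime x r \<longleftrightarrow> \<not> r dvd x" if "prime r" for r
    using that by (metis coprime_absorb_right coprime_commute not_prime_unit prime_imp_coprime)
  then show ?thesis
    using \<alpha>_pos \<beta>_pos int_primes by (simp add: n_eq coprime_mult_right_iff)
qed

text \<open>
  Adding \<open>q\<^sup>\<beta>\<close> changes the residue modulo \<open>p\<close> but no residue modulo a divisor of \<open>q\<^sup>\<beta>\<close>.
\<close>
lemma translate_by_q_power: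
  assumes "x \<in> multiples n (int (p * q))"
  defines "y \<equiv> (x + int q ^ \<beta>) mod int n"
  shows "y \<in> {0..<int n}" "int q dvd y" "\<not> int p dvd y"
    and "a dvd int q ^ \<beta> \<Longrightarrow> a dvd y \<longleftrightarrow> a dvd x"
proof -
  have x: "int p dvd x" "int q dvd x"
    using assms(1) pq_dvd_iff by (auto simp: multiples_def)
  have n: "int n = int p ^ \<alpha> * int q ^ \<beta>" by (simp add: n_eq)
  show "y \<in> {0..<int n}" using n_gt_1 by (simp add: y_def)
  show dvd: "a dvd y \<longleftrightarrow> a dvd x" if "a dvd int q ^ \<beta>" for a
    using that by (simp add: y_def n dvd_mod_iff dvd_add_left_iff)
  show "int q dvd y"
    using dvd[of "int q"] x \<beta>_pos by (simp add: dvd_power)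
  have "\<not> int p dvd int q ^ \<beta>"
    using int_primes not_dvd prime_dvd_power by blast
  then show "\<not> int p dvd y"
    using x int_dvd_n by (simp add: y_def dvd_mod_iff dvd_add_right_iff)
qed

lemma card_translates:
  assumes "A \<subseteq> {0..<int n}" shows "card ((\<lambda>x. (x + c) mod int n) ` A) = card A"
  using assms by (intro card_image inj_on_subset[OF inj_on_translation_mod])

lemma card_multiples_pq: "card (multiples n (int (p * q))) = p ^ (\<alpha> - 1) * q ^ (\<beta> - 1)"
  using prime_p prime_q by (intro card_multiples n_eq_mult) (simp add: prime_gt_0_nat)

text \<open>
  The hypothesis puts the whole translate of the multiples of \<open>pq\<close> by \<open>q\<^sup>\<beta>\<close> into \<open>X\<close>.
\<close>
lemma card_multiples_le_one_sided:
  assumes X: "X \<subseteq> {0..<int n}"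
    and U: "\<And>x. x \<in> {0..<int n} \<Longrightarrow> int q dvd x \<Longrightarrow> \<not> int p dvd x \<Longrightarrow> x \<in> X"
  shows "p ^ (\<alpha> - 1) * q ^ (\<beta> - 1) \<le> card (X - unit_residues n)"
proof -
  let ?D = "multiples n (int (p * q))" and ?t = "\<lambda>x. (x + int q ^ \<beta>) mod int n"
  have "?t ` ?D \<subseteq> X - unit_residues n"
    using translate_by_q_power(1-3) U by (auto simp: unit_residues_def coprime_n_iff)
  then have "card (?t ` ?D) \<le> card (X - unit_residues n)"
    using X by (intro card_mono) (auto intro: finite_subset)
  also have "card (?t ` ?D) = card ?D"
    by (intro card_translates) (auto simp: multiples_def)
  finally show ?thesis
    by (simp only: card_multiples_pq)
qed

text \<open>
  The multiples of \<open>pq\<close> are covered by three sets: those divisible by \<open>a\<close> and \<open>b\<close> stay in place, those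
  not divisible by \<open>a\<close> move by \<open>q\<^sup>\<beta>\<close>, those not divisible by \<open>b\<close> move by \<open>p\<^sup>\<alpha>\<close>. The images are told
  apart by which of the two primes divide their elements.
\<close>
lemma card_multiples_le_by_translation:
  assumes X: "X \<subseteq> {0..<int n}"
    and a: "a dvd int q ^ \<beta>" and b: "b dvd int p ^ \<alpha>"
    and Xpq: "\<And>x. x \<in> {0..<int n} \<Longrightarrow> a dvd x \<Longrightarrow> b dvd x \<Longrightarrow> x \<in> X"
    and Xq: "\<And>x. x \<in> {0..<int n} \<Longrightarrow> int q dvd x \<Longrightarrow> \<not> int p dvd x \<Longrightarrow> \<not> a dvd x \<Longrightarrow> x \<in> X"
    and Xp: "\<And>x. x \<in> {0..<int n} \<Longrightarrow> int p dvd x \<Longrightarrow> \<not> int q dvd x \<Longrightarrow> \<not> b dvd x \<Longrightarrow> x \<in> X"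
  shows "p ^ (\<alpha> - 1) * q ^ (\<beta> - 1) \<le> card (X - unit_residues n)"
proof -
  interpret S: two_prime_divisors q p \<beta> \<alpha> n by (rule swap)
  let ?t = "\<lambda>x. (x + int q ^ \<beta>) mod int n" and ?t' = "\<lambda>x. (x + int p ^ \<alpha>) mod int n"
  let ?D = "multiples n (int (p * q))"
  define D1 where "D1 = {x \<in> ?D. a dvd x \<and> b dvd x}"
  define D2 where "D2 = {x \<in> ?D. \<not> a dvd x}"
  define D3 where "D3 = {x \<in> ?D. \<not> b dvd x}"
  have D_sub: "?D \<subseteq> {0..<int n}" by (auto simp: multiples_def)
  then have fin: "finite D1" "finite D2" "finite D3"
    by (auto simp: D1_def D2_def D3_def intro: finite_subset)
  have pqD: "int p dvd x" "int q dvd x" if "x \<in> ?D" for x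
    using that pq_dvd_iff by (auto simp: multiples_def)
  have t: "?t x \<in> X - unit_residues n" "int q dvd ?t x" "\<not> int p dvd ?t x" if "x \<in> D2" for x
  proof -
    have x: "x \<in> ?D" "\<not> a dvd x" using that by (auto simp: D2_def)
    note tr = translate_by_q_power[OF x(1)]
    show *: "int q dvd ?t x" "\<not> int p dvd ?t x" using tr by auto
    have "\<not> a dvd ?t x" using tr(4)[OF a] x by simp
    then show "?t x \<in> X - unit_residues n" using Xq tr(1) * by (auto simp: unit_residues_def coprime_n_iff)
  qed
  have t': "?t' x \<in> X - unit_residues n" "int p dvd ?t' x" "\<not> int q dvd ?t' x" if "x \<in> D3" for x
  proof -
    have x: "x \<in> multiples n (int (q * p))" "\<not> b dvd x"
      using that by (auto simp: D3_def mult.commute)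
    note tr = S.translate_by_q_power[OF x(1)]
    show *: "int p dvd ?t' x" "\<not> int q dvd ?t' x" using tr by auto
    have "\<not> b dvd ?t' x" using tr(4)[OF b] x by simp
    then show "?t' x \<in> X - unit_residues n" using Xp tr(1) * by (auto simp: unit_residues_def coprime_n_iff)
  qed
  have "card ?D \<le> card (D1 \<union> (D2 \<union> D3))"
    using fin by (intro card_mono) (auto simp: D1_def D2_def D3_def)
  also have "\<dots> \<le> card D1 + (card D2 + card D3)"
    using card_Un_le[of D1 "D2 \<union> D3"] card_Un_le[of D2 D3] by simp
  also have "\<dots> = card D1 + (card (?t ` D2) + card (?t' ` D3))"
    using D_sub by (subst (1 2) card_translates) (auto simp: D2_def D3_def)
  also have "card (?t ` D2) + card (?t' ` D3) = card (?t ` D2 \<union> ?t' ` D3)"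
  proof (rule card_Un_disjoint[symmetric])
    show "?t ` D2 \<inter> ?t' ` D3 = {}"
      using t(3) t'(2) by fastforce
  qed (use fin in auto)
  also have "card D1 + \<dots> = card (D1 \<union> (?t ` D2 \<union> ?t' ` D3))"
  proof (rule card_Un_disjoint[symmetric])
    have "x \<in> ?D" if "x \<in> D1" for x using that by (simp add: D1_def)
    then show "D1 \<inter> (?t ` D2 \<union> ?t' ` D3) = {}"
      using pqD t(3) t'(3) by fastforce
  qed (use fin in auto)
  also have "\<dots> \<le> card (X - unit_residues n)"
  proof (rule card_mono)
    have "x \<in> X - unit_residues n" if "x \<in> D1" for x
      using that Xpq pqD D_sub by (auto simp: D1_def unit_residues_def coprime_n_iff)
    then show "D1 \<union> (?t ` D2 \<union> ?t' ` D3) \<subseteq> X - unit_residues n"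
      using t(1) t'(1) by blast
  qed (use X in \<open>auto intro: finite_subset\<close>)
  finally show ?thesis by (simp only: card_multiples_pq)
qed

theorem card_disconnecting_set:
  assumes X: "X \<subseteq> {0..<int n}" and dis: "disconnected (delete_verts (cyclic_power_graph n) X)"
  shows "totient n + p ^ (\<alpha> - 1) * q ^ (\<beta> - 1) \<le> card X"
proof -
  interpret S: two_prime_divisors q p \<beta> \<alpha> n by (rule swap)
  let ?H = "delete_verts (cyclic_power_graph n) X"
  let ?V = "{0..<int n} - X"
  have n0: "n > 0" using n_gt_1 by simp
  have nq: "int n = int p ^ \<alpha> * int q ^ \<beta>" by (simp add: n_eq)
  have finX: "finite X" using X by (auto intro: finite_subset)
  interpret H: pseudo_graph ?H
    using n0 by (intro pseudo_graph.pseudo_graph_delete_verts pseudo_graph_cyclic_power_graph)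
  have verts: "verts ?H = ?V"
    using n0 by (simp add: delete_verts_def verts_cyclic_power_graph[simplified])
  \<comment> \<open>No remaining vertex reaches all the others.\<close>
  have no_hub: False if "w \<in> ?V" "\<And>x. x \<in> ?V \<Longrightarrow> w \<rightarrow>\<^sup>*\<^bsub>?H\<^esub> x" for w
    using dis H.strongly_connected_if_all_reachable[of w] that verts
    by (simp add: disconnected_def H.connected_iff_strongly_connected)
  note reachI = reachable_cyclic_power_graphI[OF n0]
  have unit_residues_subset: "unit_residues n \<subseteq> X"
  proof
    fix g assume g: "g \<in> unit_residues n"
    then have "gcd g (int n) = 1" by (simp add: unit_residues_def)
    then have "g \<rightarrow>\<^sup>*\<^bsub>?H\<^esub> x" if "g \<notin> X" "x \<in> ?V" for x
      using that g by (intro reachI) (auto simp: unit_residues_def)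
    then show "g \<in> X" using no_hub[of g] g by (auto simp: unit_residues_def)
  qed
  have main: "p ^ (\<alpha> - 1) * q ^ (\<beta> - 1) \<le> card (X - unit_residues n)"
  proof -
    define U where "U = {x \<in> ?V. int q dvd x \<and> \<not> int p dvd x}"
    define U' where "U' = {x \<in> ?V. int p dvd x \<and> \<not> int q dvd x}"
    consider "U = {}" | "U' = {}" | "U \<noteq> {}" "U' \<noteq> {}" by blast
    then show ?thesis
    proof cases
      case 1
      then show ?thesis using X by (intro card_multiples_le_one_sided) (auto simp: U_def)
    next
      case 2
      then show ?thesis using X S.card_multiples_le_one_sided[of X] by (auto simp: U'_def mult.commute)
    next
      case 3
      obtain u where u: "u \<in> U" "\<And>x. x \<in> U \<Longrightarrow> gcd u (int q ^ \<beta>) dvd x"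
        using ex_least_prime_power_part[OF int_primes(2) 3(1)] by blast
      obtain v where v: "v \<in> U'" "\<And>x. x \<in> U' \<Longrightarrow> gcd v (int p ^ \<alpha>) dvd x"
        using ex_least_prime_power_part[OF int_primes(1) 3(2)] by blast
      define a where "a = gcd u (int q ^ \<beta>)"
      define b where "b = gcd v (int p ^ \<alpha>)"
      have a: "a dvd int q ^ \<beta>" "gcd u (int n) = a"
      proof -
        have "coprime u (int p ^ \<alpha>)"
          using u(1) int_primes by
            (metis (mono_tags, lifting) U_def coprime_commute coprime_power_right_iff mem_Collect_eq prime_imp_coprime)
        then show "gcd u (int n) = a" by (simp add: a_def nq gcd_mult_right_left_cancel)
      qed (simp add: a_def)
      have b: "b dvd int p ^ \<alpha>" "gcd v (int n) = b"
      proof -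
        have "coprime v (int q ^ \<beta>)"
          using v(1) int_primes by
            (metis (mono_tags, lifting) U'_def coprime_commute coprime_power_right_iff mem_Collect_eq prime_imp_coprime)
        then show "gcd v (int n) = b" by (simp add: b_def nq gcd_mult_right_right_cancel)
      qed (simp add: b_def)
      have uv: "u \<in> ?V" "v \<in> ?V" using u v by (auto simp: U_def U'_def)
      \<comment> \<open>A remaining common multiple of \<open>a\<close> and \<open>b\<close> would be a hub: it reaches the multiples of \<open>a\<close>
        through \<open>u\<close>, those of \<open>b\<close> through \<open>v\<close>, and all other vertices directly.\<close>
      have W: "w \<in> X" if w: "w \<in> {0..<int n}" "a dvd w" "b dvd w" for w
      proof (rule ccontr)
        assume "w \<notin> X"
        with w have wV: "w \<in> ?V" by simp
        have wu: "w \<rightarrow>\<^sup>*\<^bsub>?H\<^esub> u" using wV uv w a by (intro reachI) auto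
        have wv: "w \<rightarrow>\<^sup>*\<^bsub>?H\<^esub> v" using wV uv w b by (intro reachI) auto
        show False
        proof (rule no_hub[OF wV])
          fix x assume x: "x \<in> ?V"
          consider "a dvd x" | "b dvd x" | "\<not> a dvd x" "\<not> b dvd x" by blast
          then show "w \<rightarrow>\<^sup>*\<^bsub>?H\<^esub> x"
          proof cases
            case 1
            then have "u \<rightarrow>\<^sup>*\<^bsub>?H\<^esub> x" using x uv a by (intro reachI) auto
            with wu show ?thesis by (rule H.reachable_trans)
          next
            case 2
            then have "v \<rightarrow>\<^sup>*\<^bsub>?H\<^esub> x" using x uv b by (intro reachI) auto
            with wv show ?thesis by (rule H.reachable_trans)
          next
            case 3
            then have "gcd x (int n) dvd w"
              unfolding nq using gcd_dvd_if_prime_powers_not_dvd[OF int_primes a(1) b(1) w(2,3)] by blast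
            then show ?thesis using x wV by (intro reachI) auto
          qed
        qed
      qed
      show ?thesis
      proof (rule card_multiples_le_by_translation[OF X a(1) b(1) W])
        fix x assume "x \<in> {0..<int n}" "int q dvd x" "\<not> int p dvd x" "\<not> a dvd x"
        then show "x \<in> X" using u(2)[of x] by (auto simp: U_def a_def)
      next
        fix x assume "x \<in> {0..<int n}" "int p dvd x" "\<not> int q dvd x" "\<not> b dvd x"
        then show "x \<in> X" using v(2)[of x] by (auto simp: U'_def b_def)
      qed
    qed
  qed
  have "card X = card (X - unit_residues n) + card (unit_residues n)"
    using unit_residues_subset finX by (metis card_Diff_subset card_mono finite_subset le_add_diff_inverse2)
  then show ?thesis using main card_unit_residues[OF n_gt_1] by simp
qed

text \<open>
  The remaining vertices are divisible by exactly one of the primes, and adjacent ones by the same prime: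
  if \<open>gcd x n\<close> divides \<open>y\<close>, the one of \<open>p\<close>, \<open>q\<close> that divides \<open>x\<close> also divides \<open>y\<close>.
\<close>
lemma disconnected_delete_S_multiples:
  "disconnected (delete_verts (cyclic_power_graph n) (S_set n \<union> multiples n (int (p * q))))"
proof -
  let ?X = "S_set n \<union> multiples n (int (p * q))"
  let ?H = "delete_verts (cyclic_power_graph n) ?X"
  interpret S: two_prime_divisors q p \<beta> \<alpha> n by (rule swap)
  have n0: "n > 0" using n_gt_1 by simp
  interpret H: pseudo_graph ?H
    using n0 by (intro pseudo_graph.pseudo_graph_delete_verts pseudo_graph_cyclic_power_graph)
  have mem: "x \<in> {0..<int n} - ?X \<longleftrightarrow> x \<in> {0..<int n} \<and> (int p dvd x \<longleftrightarrow> \<not> int q dvd x)" for x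
    using pq_dvd_iff[of x] S_set_eq[OF n_gt_1]
    by (auto simp: multiples_def unit_residues_def coprime_n_iff)
  have verts: "verts ?H = {0..<int n} - ?X"
    using n0 by (simp add: delete_verts_def verts_cyclic_power_graph[simplified])
  have p: "int p \<in> verts ?H" and q: "int q \<in> verts ?H"
    unfolding verts mem using p_less_n S.p_less_n not_dvd by auto
  have "\<not> int p \<rightarrow>\<^sup>*\<^bsub>?H\<^esub> int q"
  proof
    assume "int p \<rightarrow>\<^sup>*\<^bsub>?H\<^esub> int q"
    then have "int q \<in> {x. int p dvd x \<and> \<not> int q dvd x}"
    proof (rule H.reachable_in_closed_set)
      fix x y assume x: "x \<in> {x. int p dvd x \<and> \<not> int q dvd x}" and "x \<rightarrow>\<^bsub>?H\<^esub> y"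
      then have y: "y \<in> {0..<int n} - ?X" "gcd x (int n) dvd y \<or> gcd y (int n) dvd x"
        by (auto simp only: adjacent_cyclic_power_graph_iff[OF n0])
      have "int p dvd gcd x (int n)" using x int_dvd_n by simp
      moreover have "\<not> int q dvd y" if "gcd y (int n) dvd x"
        using that x int_dvd_n(3) dvd_trans[of "int q" "gcd y (int n)" x] by auto
      ultimately show "y \<in> {x. int p dvd x \<and> \<not> int q dvd x}"
        using y mem[of y] dvd_trans by auto
    qed (use not_dvd in auto)
    then show False using not_dvd by simp
  qed
  then show ?thesis
    using p q unfolding disconnected_def H.connected_iff_strongly_connected strongly_connected_def
    by blast
qed

lemma card_S_set: "card (S_set n) = totient n + 1"
proof -
  have "0 \<notin> unit_residues n" using n_gt_1 by (auto simp: unit_residues_def)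
  then show ?thesis using n_gt_1 by (simp add: S_set_eq card_unit_residues finite_unit_residues)
qed

lemma card_S_multiples:
  "card (S_set n \<union> multiples n (int (p * q))) = totient n + p ^ (\<alpha> - 1) * q ^ (\<beta> - 1)"
proof -
  have "S_set n \<union> multiples n (int (p * q)) = unit_residues n \<union> multiples n (int (p * q))"
    using n_gt_1 by (auto simp: S_set_eq multiples_def)
  moreover have "unit_residues n \<inter> multiples n (int (p * q)) = {}"
    using pq_dvd_iff by (auto simp: unit_residues_def multiples_def coprime_n_iff)
  ultimately show ?thesis
    using card_unit_residues[OF n_gt_1] card_multiples_pq
    by (simp only: card_Un_disjoint finite_unit_residues finite_multiples)
qed

text \<open>
  Deleting all vertices but one also counts in the definition of connectivity, but this
  is never cheaper than deleting the units and the multiples of \<open>pq\<close>, which leaves the vertex \<open>p\<close>.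
\<close>
theorem vertex_connectivity_cyclic_power_graph:
  "vertex_connectivity (cyclic_power_graph n) = totient n + p ^ (\<alpha> - 1) * q ^ (\<beta> - 1)"
  unfolding vertex_connectivity_def
proof (rule Least_equality, goal_cases)
  let ?X = "S_set n \<union> multiples n (int (p * q))"
  have sub: "?X \<subseteq> {0..<int n}"
    using n_gt_1 by (auto simp: S_set_eq unit_residues_def multiples_def)
  have V: "verts (cyclic_power_graph n) = {0..<int n}"
    using n_gt_1 by (intro verts_cyclic_power_graph) simp
  {
    case 1
    show ?case
      unfolding V using sub disconnected_delete_S_multiples card_S_multiples by blast
  next
    case (2 k)
    then obtain X where X: "X \<subseteq> {0..<int n}" "card X = k" and
      *: "disconnected (delete_verts (cyclic_power_graph n) X) \<or>
          trivial_graph (delete_verts (cyclic_power_graph n) X)"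
      using V by auto
    show ?case
    proof (cases "disconnected (delete_verts (cyclic_power_graph n) X)")
      case True
      then show ?thesis using card_disconnecting_set X by blast
    next
      case False
      then have "card ({0..<int n} - X) = 1"
        using * V by (simp add: trivial_graph_def delete_verts_def)
      then have "k = n - 1"
        using X card_mono[OF _ X(1)] by (simp add: card_Diff_subset finite_subset[OF X(1)])
      moreover have "int p \<notin> ?X"
        using not_dvd n_gt_1 prime_p by (auto simp: S_set_eq multiples_def pq_dvd_iff[simplified] unit_residues_def coprime_n_iff)
      then have "?X \<subseteq> {0..<int n} - {int p}" using sub by blast
      then have "card ?X \<le> card ({0..<int n} - {int p})" by (intro card_mono) auto
      ultimately show ?thesis using p_less_n card_S_multiples by simp
    qed
  }
qed

text \<open>
  Since \<open>pq\<close> is a vertex of the reduced graph, that graph has a single component, and separating it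
  means disconnecting it. Passing to the reduced graph accounts for \<open>\<phi>(n) + 1\<close> deleted vertices, the
  units and \<open>0\<close>, which leaves \<open>|D| - 1\<close> of the lower bound for the full graph.
\<close>
theorem minimum_separating_set_reduced_power_graph:
  assumes "n \<noteq> p * q"
  shows "minimum_separating_set (reduced_power_graph n) (multiples n (int (p * q)) - {0})"
proof -
  let ?D = "multiples n (int (p * q))"
  have n0: "n > 0" using n_gt_1 by simp
  have red: "delete_verts (reduced_power_graph n) Y = delete_verts (cyclic_power_graph n) (S_set n \<union> Y)" for Y
    by (simp add: reduced_power_graph_def delete_verts_delete_verts)
  interpret R: pseudo_graph "reduced_power_graph n"
    unfolding reduced_power_graph_def
    using n0 by (intro pseudo_graph.pseudo_graph_delete_verts pseudo_graph_cyclic_power_graph)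
  have verts: "verts (reduced_power_graph n) = {0..<int n} - S_set n"
    using n0 by (simp add: reduced_power_graph_def delete_verts_def verts_cyclic_power_graph[simplified])
  have mem: "x \<in> {0..<int n} - S_set n \<longleftrightarrow> x \<in> {0..<int n} \<and> x \<noteq> 0 \<and> (int p dvd x \<or> int q dvd x)" for x
    using S_set_eq[OF n_gt_1] by (auto simp: unit_residues_def coprime_n_iff)
  interpret S: two_prime_divisors q p \<beta> \<alpha> n by (rule swap)
  have pos: "p > 0" "q > 0" using prime_p prime_q by (auto simp: prime_gt_0_nat)
  have "p * q < n"
    using assms dvd_n(1) n0 by (simp add: dvd_imp_le le_neq_implies_less)
  then have pq: "int (p * q) \<in> {0..<int n} - S_set n"
    unfolding mem using pos by (auto simp flip: of_nat_mult)
  have p: "int p \<in> {0..<int n} - S_set n" and q: "int q \<in> {0..<int n} - S_set n"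
    unfolding mem using p_less_n S.p_less_n pos by auto
  note reachI = reachable_cyclic_power_graphI[OF n0, where X = "S_set n", folded reduced_power_graph_def]
  have "strongly_connected (reduced_power_graph n)"
  proof (rule R.strongly_connected_if_all_reachable)
    show "int (p * q) \<in> verts (reduced_power_graph n)" using pq verts by simp
    fix x assume "x \<in> verts (reduced_power_graph n)"
    then have x: "x \<in> {0..<int n} - S_set n" using verts by simp
    have "int (p * q) \<rightarrow>\<^sup>*\<^bsub>reduced_power_graph n\<^esub> r \<and> r \<rightarrow>\<^sup>*\<^bsub>reduced_power_graph n\<^esub> x"
      if "r \<in> {0..<int n} - S_set n" "r dvd int (p * q)" "r dvd x" for r
      using that x pq by (intro conjI reachI) (auto intro: dvd_trans[OF gcd_dvd1])
    moreover have "int p dvd x \<or> int q dvd x" using x mem by blast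
    ultimately show "int (p * q) \<rightarrow>\<^sup>*\<^bsub>reduced_power_graph n\<^esub> x"
      using p q R.reachable_trans by (metis dvd_triv_left dvd_triv_right of_nat_mult)
  qed
  then have sccs: "card R.sccs = 1" by (simp add: R.strongly_connected_eq_iff)
  have sep: "separating_set (reduced_power_graph n) Y \<longleftrightarrow>
      Y \<subseteq> {0..<int n} - S_set n \<and> disconnected (delete_verts (cyclic_power_graph n) (S_set n \<union> Y))" for Y
    using pseudo_graph.disconnected_iff_card_sccs[OF R.pseudo_graph_delete_verts[of Y]]
    by (simp add: separating_set_def sccs verts red)
  have "S_set n \<union> (?D - {0}) = S_set n \<union> ?D"
    using n_gt_1 by (auto simp: S_set_eq)
  moreover have "?D - {0} \<subseteq> {0..<int n} - S_set n"
    using pq_dvd_iff mem by (auto simp: multiples_def)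
  ultimately have "separating_set (reduced_power_graph n) (?D - {0})"
    using disconnected_delete_S_multiples by (simp add: sep)
  moreover have "card (?D - {0}) \<le> card Y" if "separating_set (reduced_power_graph n) Y" for Y
  proof -
    have Y: "Y \<subseteq> {0..<int n} - S_set n"
      "disconnected (delete_verts (cyclic_power_graph n) (S_set n \<union> Y))"
      using that sep by auto
    have S: "S_set n \<subseteq> {0..<int n}" using n_gt_1 by (auto simp: S_set_eq unit_residues_def)
    have "totient n + p ^ (\<alpha> - 1) * q ^ (\<beta> - 1) \<le> card (S_set n \<union> Y)"
      using Y S by (intro card_disconnecting_set) auto
    also have "\<dots> \<le> totient n + 1 + card Y"
      using card_Un_le[of "S_set n" Y] card_S_set by simp
    finally have "card ?D - 1 \<le> card Y" by (simp add: card_multiples_pq[simplified])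
    moreover have "0 \<in> ?D" using n0 by (simp add: multiples_def)
    ultimately show ?thesis by simp
  qed
  ultimately show ?thesis by (simp add: minimum_separating_set_def)
qed

end

theorem theorem2p27:
  fixes n p q \<alpha> \<beta> :: nat
  assumes "prime p" and "prime q" and "p \<noteq> q"
    and "\<alpha> \<ge> 1" and "\<beta> \<ge> 1"
    and "n = p ^ \<alpha> * q ^ \<beta>"
  shows "vertex_connectivity (power_graph (integer_mod_group n))
           = totient n + p ^ (\<alpha> - 1) * q ^ (\<beta> - 1)
         \<and> (n \<noteq> p * q \<longrightarrow>
              minimum_separating_set (reduced_power_graph n)
                (nonzero_part n (cyclic_subgroup n (residue_class n (p * q)))))"
proof -
  interpret two_prime_divisors p q \<alpha> \<beta> n
    using assms by unfold_locales
  have "nonzero_part n (cyclic_subgroup n (residue_class n (p * q))) = multiples n (int (p * q)) - {0}"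
    using n_gt_1 dvd_n(1) cyclic_subgroup_eq_multiples[of n "p * q"]
    by (simp add: nonzero_part_def residue_class_def[of n 0])
  then show ?thesis
    using vertex_connectivity_cyclic_power_graph minimum_separating_set_reduced_power_graph by simp
qed

end
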